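(* Let $n,m\ge 1$ be integers, $t>0$, $\Delta t=t/m$, let $G:\mathbb{R}\times\mathbb{R}^n\to\mathbb{R}^n$ be differentiable, and let $x_0\in\mathbb{R}^n$. Let $E(t,m,\cdot)$ be the implicit Euler map with $m$ uniform steps, let $x_1,\dots,x_m$ be the implicit Euler iterates started at $x_0$, and let $F_i$ be the residual of the $i$-th step (all as defined in the context). Assume that $E$ is differentially invertible at $(t,m,x_0)$. Then for every $v\in\mathbb{R}^n$, $$E'(t,m,x_0)^{-1}\cdot v=\frac{\partial F_1}{\partial x}(x_1,x_0,\Delta t)\cdot\frac{\partial F_2}{\partial x}(x_2,x_1,\Delta t)\cdots\frac{\partial F_m}{\partial x}(x_m,x_{m-1},\Delta t)\cdot v .$$
   Context: For $i=1,\dots,m$ the residual of the $i$-th implicit Euler step is $$F_i(x,z,\Delta t)=x-z-\Delta t\cdot G(i\,\Delta t,x),\qquad x,z\in\mathbb{R}^n,$$ and $\frac{\partial F_i}{\partial x}(x,z,\Delta t)=I_n-\Delta t\cdot\frac{\partial G}{\partial x}(i\,\Delta t,x)\in\mathbb{R}^{n\times n}$ denotes its Jacobian with respect to its first argument. The implicit Euler iterates $x_1,\dots,x_m$ for the system $\frac{dx}{dt}=G(t,x(t))$ with initial state $x_0$ satisfy $F_i(x_i,x_{i-1},\Delta t)=0$ for $i=1,\dots,m$. Standing assumption: for each $i$ this equation defines $x_i$ implicitly as a differentiable function of $x_{i-1}$, i.e. there are an open neighborhood $U_{i-1}$ of $x_{i-1}$ and a map $\varphi_i:U_{i-1}\to\mathbb{R}^n$,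 differentiable at $x_{i-1}$, with $\varphi_i(x_{i-1})=x_i$ and $F_i(\varphi_i(z),z,\Delta t)=0$ for all $z\in U_{i-1}$. For $x$ in a neighborhood of $x_0$, the implicit Euler map is $E(t,m,x)=\varphi_m(\cdots\varphi_1(x)\cdots)$, so that $E(t,m,x_0)=x_m$. $E'(t,m,x_0)=\frac{dE}{dx}(t,m,x_0)\in\mathbb{R}^{n\times n}$ is the Jacobian with respect to the initial state. $E$ is called differentially invertible at $(t,m,x_0)$ if it is differentiable with respect to the initial state there and $E'(t,m,x_0)$ is invertible. *)

theory Defs
  imports "HOL-Analysis.Analysis"
begin

definition euler_residual ::
  "(real \<times> (real ^ 'n) \<Rightarrow> real ^ 'n) \<Rightarrow> nat \<Rightarrow> real ^ 'n \<Rightarrow> real ^ 'n \<Rightarrow> real \<Rightarrow> real ^ 'n"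
  where "euler_residual G i x z dt = x - z - dt *\<^sub>R G (real i * dt, x)"

definition residual_jacobian ::
  "(real \<times> (real ^ 'n) \<Rightarrow> real ^ 'n) \<Rightarrow> nat \<Rightarrow> real ^ 'n \<Rightarrow> real ^ 'n \<Rightarrow> real \<Rightarrow> real ^ 'n ^ 'n"
  where "residual_jacobian G i x z dt = jacobian (\<lambda>y. euler_residual G i y z dt) (at x)"

lemma residual_jacobian_eq:
  fixes G :: "real \<times> (real ^ 'n) \<Rightarrow> real ^ 'n"
  assumes "G differentiable at (real i * dt, x)"
  shows "residual_jacobian G i x z dt =
    mat 1 - dt *\<^sub>R jacobian (\<lambda>y. G (real i * dt, y)) (at x)"
proof -
  let ?g = "\<lambda>y. G (real i * dt, y)"
  have "(G \<circ> (\<lambda>y. (real i * dt, y))) differentiable at x"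
    by (rule differentiable_chain_at)
      (use assms in \<open>auto simp: differentiable_def intro!: exI derivative_eq_intros\<close>)
  then have "(?g has_derivative (\<lambda>h. jacobian ?g (at x) *v h)) (at x)"
    by (simp add: o_def jacobian_works)
  then have "((\<lambda>y. euler_residual G i y z dt) has_derivative
      (\<lambda>h. h - dt *\<^sub>R (jacobian ?g (at x) *v h))) (at x)"
    unfolding euler_residual_def by (auto intro!: derivative_eq_intros)
  then have "frechet_derivative (\<lambda>y. euler_residual G i y z dt) (at x) =
      (\<lambda>h. (mat 1 - dt *\<^sub>R jacobian ?g (at x)) *v h)"
    by (subst frechet_derivative_at[symmetric])
      (auto simp: fun_eq_iff matrix_vector_mult_diff_rdistrib scaleR_matrix_vector_assoc)
  then show ?thesis
    by (simp add: residual_jacobian_def jacobian_def)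
qed

text \<open>
  \<open>x 0\<close> is the initial state and \<open>x 1, \<dots>, x m\<close> are the iterates.  The implicit functions
  \<open>\<phi> i\<close> are total in HOL, but they are constrained only on the neighbourhood \<open>U\<close>
  of \<open>x (i - 1)\<close>; since each \<open>\<phi> i\<close> is continuous at \<open>x (i - 1)\<close>, the composition
  of the restricted maps is defined near \<open>x 0\<close> and agrees there with \<open>euler_map \<phi> m\<close>.
\<close>

definition implicit_euler ::
  "(real \<times> (real ^ 'n) \<Rightarrow> real ^ 'n) \<Rightarrow> real \<Rightarrow> nat \<Rightarrow> (nat \<Rightarrow> real ^ 'n)
    \<Rightarrow> (nat \<Rightarrow> real ^ 'n \<Rightarrow> real ^ 'n) \<Rightarrow> bool"
  where "implicit_euler G dt m x \<phi> \<longleftrightarrow>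
    (\<forall>i\<in>{1..m}.
      euler_residual G i (x i) (x (i - 1)) dt = 0 \<and>
      (\<exists>U. open U \<and> x (i - 1) \<in> U \<and>
        \<phi> i differentiable at (x (i - 1)) \<and>
        \<phi> i (x (i - 1)) = x i \<and>
        (\<forall>z\<in>U. euler_residual G i (\<phi> i z) z dt = 0)))"

primrec euler_map :: "(nat \<Rightarrow> real ^ 'n \<Rightarrow> real ^ 'n) \<Rightarrow> nat \<Rightarrow> real ^ 'n \<Rightarrow> real ^ 'n"
  where
    "euler_map \<phi> 0 z = z"
  | "euler_map \<phi> (Suc k) z = \<phi> (Suc k) (euler_map \<phi> k z)"

definition differentially_invertible :: "(real ^ 'n \<Rightarrow> real ^ 'n) \<Rightarrow> real ^ 'n \<Rightarrow> bool"
  where "differentially_invertible E z \<longleftrightarrow>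
    E differentiable at z \<and> invertible (jacobian E (at z))"

definition matrix_prod_list :: "(real ^ 'n ^ 'n) list \<Rightarrow> real ^ 'n ^ 'n"
  where "matrix_prod_list As = foldr (**) As (mat 1)"

end

theory Submission
  imports Defs
begin

text \<open>
  Up to an additive constant, \<open>\<phi>\<^sub>i\<close> is a local right inverse of the residual \<open>F\<^sub>i\<close> in its first
  argument, so the Jacobian of \<open>F\<^sub>i\<close> is a left inverse of the Jacobian of \<open>\<phi>\<^sub>i\<close>.  By the chain rule
  the Jacobian of the Euler map is the product of the latter in reverse order, so multiplying it
  by the former telescopes to the identity; for square matrices a left inverse is the inverse.
\<close>

lemma jacobian_eqI:
  fixes f :: "real ^ 'n \<Rightarrow> real ^ 'm"
  assumes "(f has_derivative (*v) A) (at x)"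
  shows "jacobian f (at x) = A"
  using frechet_derivative_at[OF assms] by (metis jacobian_def matrix_of_matrix_vector_mul)

lemma has_derivative_matrix_compose:
  fixes f :: "real ^ 'n \<Rightarrow> real ^ 'm" and g :: "real ^ 'm \<Rightarrow> real ^ 'k"
  assumes "(f has_derivative (*v) A) (at x)" and "(g has_derivative (*v) B) (at (f x))"
  shows "(g \<circ> f has_derivative (*v) (B ** A)) (at x)"
  using diff_chain_at[OF assms] by (simp add: o_def matrix_vector_mul_assoc)

lemma jacobian_mult_local_right_inverse:
  fixes f :: "real ^ 'n \<Rightarrow> real ^ 'm" and g :: "real ^ 'm \<Rightarrow> real ^ 'n"
  assumes f: "f differentiable at (g z)" and g: "g differentiable at z"
    and U: "open U" "z \<in> U" and inverse: "\<And>y. y \<in> U \<Longrightarrow> f (g y) = y"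
  shows "jacobian f (at (g z)) ** jacobian g (at z) = mat 1"
proof -
  have "(f \<circ> g has_derivative (*v) (jacobian f (at (g z)) ** jacobian g (at z))) (at z)"
    using f g by (intro has_derivative_matrix_compose) (simp_all add: jacobian_works)
  then have "((\<lambda>y. y) has_derivative (*v) (jacobian f (at (g z)) ** jacobian g (at z))) (at z)"
    using U by (rule has_derivative_transform_within_open) (simp add: inverse)
  then have "jacobian (\<lambda>y. y) (at z) = jacobian f (at (g z)) ** jacobian g (at z)"
    by (rule jacobian_eqI)
  moreover have "jacobian (\<lambda>y. y) (at z) = mat 1"
    by (rule jacobian_eqI) (auto intro!: derivative_eq_intros)
  ultimately show ?thesis by simp
qed

lemma matrix_inv_unique:
  fixes A :: "'a::semiring_1 ^ 'n ^ 'm"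
  assumes "A ** B = mat 1" and left: "B ** A = mat 1"
  shows "matrix_inv A = B"
proof -
  have "\<exists>C. A ** C = mat 1 \<and> C ** A = mat 1"
    using assms by blast
  then have "A ** matrix_inv A = mat 1"
    unfolding matrix_inv_def by (rule someI2_ex) blast
  then have "B ** A ** matrix_inv A = B"
    by (simp flip: matrix_mul_assoc)
  then show ?thesis
    by (simp add: left)
qed

lemma matrix_prod_list_Nil [simp]: "matrix_prod_list [] = mat 1"
  by (simp add: matrix_prod_list_def)

lemma matrix_prod_list_Cons [simp]: "matrix_prod_list (A # As) = A ** matrix_prod_list As"
  by (simp add: matrix_prod_list_def)

lemma matrix_prod_list_append [simp]:
  "matrix_prod_list (As @ Bs) = matrix_prod_list As ** matrix_prod_list Bs"
  by (induction As) (simp_all add: matrix_mul_assoc)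

lemma matrix_prod_list_mult_rev:
  assumes "\<And>i. i \<in> set is \<Longrightarrow> A i ** B i = mat 1"
  shows "matrix_prod_list (map A is) ** matrix_prod_list (map B (rev is)) = mat 1"
  using assms
proof (induction "is")
  case Nil
  then show ?case by simp
next
  case (Cons i "is")
  let ?P = "matrix_prod_list (map A is)" and ?Q = "matrix_prod_list (map B (rev is))"
  have "(A i ** ?P) ** (?Q ** B i) = A i ** (?P ** ?Q) ** B i"
    by (simp only: matrix_mul_assoc)
  also have "\<dots> = mat 1"
    using Cons by simp
  finally show ?case by simp
qed

lemma euler_map_orbit:
  assumes "\<And>k. k < m \<Longrightarrow> \<phi> (Suc k) (x k) = x (Suc k)"
  shows "euler_map \<phi> m (x 0) = x m"
  using assms by (induction m) simp_all

lemma has_derivative_euler_map: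
  assumes "\<And>k. k < m \<Longrightarrow> \<phi> (Suc k) (x k) = x (Suc k)"
    and "\<And>k. k < m \<Longrightarrow> (\<phi> (Suc k) has_derivative (*v) (D (Suc k))) (at (x k))"
  shows "(euler_map \<phi> m has_derivative (*v) (matrix_prod_list (map D (rev [1..<Suc m])))) (at (x 0))"
  using assms
proof (induction m)
  case 0
  then show ?case by simp
next
  case (Suc k)
  let ?P = "matrix_prod_list (map D (rev [1..<Suc k]))"
  have "(euler_map \<phi> k has_derivative (*v) ?P) (at (x 0))"
    by (rule Suc.IH) (simp_all add: Suc.prems)
  moreover have "(\<phi> (Suc k) has_derivative (*v) (D (Suc k))) (at (euler_map \<phi> k (x 0)))"
    using Suc.prems by (simp add: euler_map_orbit)
  ultimately have "(\<phi> (Suc k) \<circ> euler_map \<phi> k has_derivative (*v) (D (Suc k) ** ?P)) (at (x 0))"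
    by (rule has_derivative_matrix_compose)
  then show ?case by (simp add: o_def)
qed

lemma differentiable_euler_residual:
  assumes "G differentiable at (real i * dt, x)"
  shows "(\<lambda>y. euler_residual G i y z dt) differentiable at x"
proof -
  have "Pair (real i * dt) differentiable at x"
    by simp
  then have "(\<lambda>y. G (real i * dt, y)) differentiable at x"
    using differentiable_chain_at[of "Pair (real i * dt)" x G] assms by (simp add: o_def)
  then show ?thesis
    unfolding euler_residual_def by simp
qed

lemma residual_jacobian_mult_implicit_jacobian:
  assumes G: "G differentiable at (real i * dt, \<phi> z)" and \<phi>: "\<phi> differentiable at z"
    and U: "open U" "z \<in> U" and root: "\<And>y. y \<in> U \<Longrightarrow> euler_residual G i (\<phi> y) y dt = 0"
  shows "residual_jacobian G i (\<phi> z) w dt ** jacobian \<phi> (at z) = mat 1"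
proof -
  have "euler_residual G i (\<phi> y) 0 dt = y" if "y \<in> U" for y
    using root[OF that] by (simp add: euler_residual_def algebra_simps)
  with differentiable_euler_residual[OF G] \<phi> U
  have "residual_jacobian G i (\<phi> z) 0 dt ** jacobian \<phi> (at z) = mat 1"
    unfolding residual_jacobian_def by (rule jacobian_mult_local_right_inverse)
  moreover have "residual_jacobian G i (\<phi> z) w dt = residual_jacobian G i (\<phi> z) 0 dt"
    by (simp add: residual_jacobian_eq G)
  ultimately show ?thesis by simp
qed

lemma implicit_eulerD:
  assumes "implicit_euler G dt m x \<phi>" and "i \<in> {1..m}"
  shows "\<phi> i (x (i - 1)) = x i" and "\<phi> i differentiable at (x (i - 1))"
    and "\<exists>U. open U \<and> x (i - 1) \<in> U \<and> (\<forall>z\<in>U. euler_residual G i (\<phi> i z) z dt = 0)"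
  using bspec[OF assms(1)[unfolded implicit_euler_def] assms(2)] by blast+

lemma implicit_euler_residual_jacobian_mult:
  assumes euler: "implicit_euler G dt m x \<phi>" "i \<in> {1..m}"
    and G: "G differentiable at (real i * dt, x i)"
  shows "residual_jacobian G i (x i) w dt ** jacobian (\<phi> i) (at (x (i - 1))) = mat 1"
proof -
  note step = implicit_eulerD[OF euler]
  obtain U where "open U" "x (i - 1) \<in> U"
      and "\<And>z. z \<in> U \<Longrightarrow> euler_residual G i (\<phi> i z) z dt = 0"
    using step(3) by blast
  then have "residual_jacobian G i (\<phi> i (x (i - 1))) w dt ** jacobian (\<phi> i) (at (x (i - 1))) = mat 1"
    using G step(1,2) by (intro residual_jacobian_mult_implicit_jacobian) simp_all
  then show ?thesis
    by (simp only: step(1))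
qed

lemma jacobian_implicit_euler_map:
  assumes "implicit_euler G dt m x \<phi>"
  shows "jacobian (euler_map \<phi> m) (at (x 0)) =
    matrix_prod_list (map (\<lambda>i. jacobian (\<phi> i) (at (x (i - 1)))) (rev [1..<Suc m]))"
proof (intro jacobian_eqI has_derivative_euler_map)
  fix k
  assume "k < m"
  then have "Suc k \<in> {1..m}"
    by simp
  note step = implicit_eulerD[OF assms this]
  show "\<phi> (Suc k) (x k) = x (Suc k)"
    using step(1) by simp
  show "(\<phi> (Suc k) has_derivative (*v) (jacobian (\<phi> (Suc k)) (at (x (Suc k - 1))))) (at (x k))"
    using step(2) by (simp add: jacobian_works)
qed

theorem theorem3p2:
  fixes G :: "real \<times> (real ^ 'n) \<Rightarrow> real ^ 'n"
    and t dt :: real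
    and m :: nat
    and x0 v :: "real ^ 'n"
    and x :: "nat \<Rightarrow> real ^ 'n"
    and \<phi> :: "nat \<Rightarrow> real ^ 'n \<Rightarrow> real ^ 'n"
  assumes "m \<ge> 1"
    and "t > 0"
    and "dt = t / real m"
    and "G differentiable_on UNIV"
    and "x 0 = x0"
    and "implicit_euler G dt m x \<phi>"
    and "differentially_invertible (euler_map \<phi> m) x0"
  shows "matrix_inv (jacobian (euler_map \<phi> m) (at x0)) *v v =
    matrix_prod_list (map (\<lambda>i. residual_jacobian G i (x i) (x (i - 1)) dt) [1..<Suc m]) *v v"
proof -
  let ?J = "\<lambda>i. residual_jacobian G i (x i) (x (i - 1)) dt"
  let ?D = "\<lambda>i. jacobian (\<phi> i) (at (x (i - 1)))"
  let ?P = "matrix_prod_list (map ?J [1..<Suc m])"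
  have "G differentiable at p" for p
    using \<open>G differentiable_on UNIV\<close> unfolding differentiable_on_def by blast
  then have "?J i ** ?D i = mat 1" if "i \<in> set [1..<Suc m]" for i
    using that by (intro implicit_euler_residual_jacobian_mult[OF \<open>implicit_euler G dt m x \<phi>\<close>]) auto
  then have "?P ** matrix_prod_list (map ?D (rev [1..<Suc m])) = mat 1"
    by (rule matrix_prod_list_mult_rev)
  then have "?P ** jacobian (euler_map \<phi> m) (at x0) = mat 1"
    using jacobian_implicit_euler_map[OF \<open>implicit_euler G dt m x \<phi>\<close>] \<open>x 0 = x0\<close> by (simp only:)
  then have "matrix_inv (jacobian (euler_map \<phi> m) (at x0)) = ?P"
    using matrix_inv_unique matrix_left_right_inverse1 by blast
  then show ?thesis
    by (rule arg_cong)
qed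

end
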